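(* Let $a,b$ be coprime positive integers, $n\ge1$, and let $P,Q\in\mathfrak{D}_n^{(a,b)}$ with $P\le_Y Q$ in the Young order. Let $B(Q,P)$ be the binary tree constructed from $\mathrm{Tr}(P)$ by successive rotations, as described in the context. Then the two words read from $B(Q,P)$ are $\omega_1(B(Q,P))=Q$ and $\omega_2(B(Q,P))=P$.
   Context: **Paths.** $\mathfrak{D}_n^{(a,b)}$ is the set of lattice paths from $(0,0)$ to $(bn,an)$ with unit steps $N=(0,1)$, $E=(1,0)$ staying weakly above $y=ax/b$, written as words of length $M=(a+b)n$ in $N,E$. The step sequence $(u_1,\ldots,u_{an})$ records the $x$-coordinate $u_k$ of the $k$-th $N$ step; $P\le_YQ$ means that the step sequence of $Q$ is entrywise at most that of $P$ (i.e. $Q$ lies weakly above $P$). **Binary trees and reading words.** A binary tree is a rooted tree (drawn with the root on top) in which each node has at most one left child and at most one right child; edges are left or right edges. The word $\omega(T)$ is read by walking around $T$ counterclockwise from the root: at a node $x$, $\omega(x)$ is $1\,\omega(y)\,\bar1$ for the left child $y$ (if any) followed by $2\,\omega(z)\,\bar2$ for the right child $z$ (if any). $\omega_1(T)$ is obtained from $\omega(T)$ by deleting all $1$'s and $2$'s; $\omega_2(T)$ by deleting all $1$'s and $\bar2$'s. In both, $\bar1$ is replaced by $N$ and $2$, $\bar2$ by $E$. **The tree $\mathrm{Tr}(P)$.** The tree of $N^iE^j$ consists of a root from which a chain of $i$ left edges and a chain of $j$ right edges descend. For $P=N^{i_1}E^{j_1}\cdots N^{i_r}E^{j_r}$, $\mathrm{Tr}(P)$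 is obtained recursively by attaching the root of $\mathrm{Tr}(N^{i_1}E^{j_1}\cdots N^{i_{r-1}}E^{j_{r-1}})$ at the leftmost leaf of the tree of $N^{i_r}E^{j_r}$. Put $B(P,P)=\mathrm{Tr}(P)$. **Rotation.** Suppose a tree $T=B(R,P)$ has been constructed for a path $R=r_1\cdots r_M$ with $P\le_Y R\le_Y Q=q_1\cdots q_M$ and $R\ne Q$ (initially $R=P$, $T=\mathrm{Tr}(P)$). Let $k_0$ be the smallest index with $r_{k_0}\ne q_{k_0}$; then $r_{k_0}=E$, $q_{k_0}=N$. Let $k_1>k_0$ be the first index after $k_0$ with $r_{k_1}=N$ and $k_2>k_1$ the first index after $k_1$ with $r_{k_2}=N$ ($k_2=M+1$ if there is none). Let $e_0$ be the right edge of $T$ whose letter $\bar2$ is the $k_0$-th letter of $\omega_1(T)$, and let $\mathrm{Tr}'$ be the part of $T$ corresponding to the subword $r_{k_1}\cdots r_{k_2-1}=NE\cdots E$: a node with its left edge and a chain of right edges descending from it. Cut $T$ into four pieces: $\mathrm{Tr}'$; the piece $B_r$ of $T\setminus\mathrm{Tr}'$ containing the root of $T$ (possibly a single node); and the remaining piece $B_t$ (hanging from the lower end of the left edge of $\mathrm{Tr}'$), which contains $e_0$ and is divided into $B_t^{(1)}$, the binary tree below $e_0$, and $B_t^{(0)}$, the rest, which contains $e_0$. Reglue: attach the root of $B_t^{(0)}$ at the leftmost leaf of $B_r$; attach the root of $\mathrm{Tr}'$ at the lower end of $e_0$; attach the root of $B_t^{(1)}$ at the leftmost leaf of $\mathrm{Tr}'$.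 The result is the tree $B(R_1,P)$, where $R_1$ is obtained from $R$ by exchanging the consecutive factors $r_{k_0}\cdots r_{k_1-1}=E\cdots E$ and $r_{k_1}\cdots r_{k_2-1}$. This operation is called a rotation. Applying rotations successively until the path becomes $Q$ yields $B(Q,P)$. *)

theory Defs
  imports Main "HOL-Library.Tree"
begin

section \<open>Lattice paths and the Young order\<close>

datatype step = N | E

type_synonym path = "step list"

text \<open>The line \<open>y = a x / b\<close> is used with denominators cleared. It suffices to test the lattice
  points of the path, because every step is a unit segment.\<close>

definition dyck_paths :: "nat \<Rightarrow> nat \<Rightarrow> nat \<Rightarrow> path set" where
  "dyck_paths a b n =
     {P. count_list P E = b * n \<and> count_list P N = a * n \<and>
         (\<forall>k\<le>length P. a * count_list (take k P) E \<le> b * count_list (take k P) N)}"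

definition step_sequence :: "path \<Rightarrow> nat list" where
  "step_sequence P = map (\<lambda>k. count_list (take k P) E) (filter (\<lambda>k. P ! k = N) [0..<length P])"

definition young_le :: "path \<Rightarrow> path \<Rightarrow> bool" (infix \<open>\<le>\<^sub>Y\<close> 50) where
  "P \<le>\<^sub>Y Q \<longleftrightarrow> list_all2 (\<le>) (step_sequence Q) (step_sequence P)"


section \<open>Binary trees and their words\<close>

text \<open>A node of the tree is a constructor \<^term>\<open>Node\<close>; the constructor \<^term>\<open>Leaf\<close> only marks the
  absence of a child. A leaf in the graph-theoretic sense is a node without children; the smallest
  rooted tree is \<^term>\<open>\<langle>\<langle>\<rangle>, (), \<langle>\<rangle>\<rangle>\<close>.\<close>

type_synonym bintree = "unit tree"

abbreviation single :: bintree where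
  "single \<equiv> \<langle>\<langle>\<rangle>, (), \<langle>\<rangle>\<rangle>"

datatype letter = One | OneBar | Two | TwoBar

fun omega :: "bintree \<Rightarrow> letter list" where
  "omega \<langle>\<rangle> = []"
| "omega \<langle>l, _, r\<rangle> =
     (if l = \<langle>\<rangle> then [] else One # omega l @ [OneBar]) @
     (if r = \<langle>\<rangle> then [] else Two # omega r @ [TwoBar])"

fun step_of :: "letter \<Rightarrow> step" where
  "step_of OneBar = N"
| "step_of Two = E"
| "step_of TwoBar = E"

definition omega1 :: "bintree \<Rightarrow> path" where
  "omega1 T = map step_of (filter (\<lambda>c. c \<noteq> One \<and> c \<noteq> Two) (omega T))"

definition omega2 :: "bintree \<Rightarrow> path" where
  "omega2 T = map step_of (filter (\<lambda>c. c \<noteq> One \<and> c \<noteq> TwoBar) (omega T))"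


section \<open>Positions, cutting and gluing\<close>

datatype side = Lft | Rgt

text \<open>A position is the sequence of turns leading from the root to a node. An edge is identified
  with the position of its lower end.\<close>

type_synonym position = "side list"

text \<open>The word \<^term>\<open>omega T\<close> with every letter tagged by the edge that it comes from.\<close>

fun tagged_omega :: "bintree \<Rightarrow> (letter \<times> position) list" where
  "tagged_omega \<langle>\<rangle> = []"
| "tagged_omega \<langle>l, _, r\<rangle> =
     (if l = \<langle>\<rangle> then []
      else (One, [Lft]) # map (\<lambda>(c, p). (c, Lft # p)) (tagged_omega l) @ [(OneBar, [Lft])]) @
     (if r = \<langle>\<rangle> then []
      else (Two, [Rgt]) # map (\<lambda>(c, p). (c, Rgt # p)) (tagged_omega r) @ [(TwoBar, [Rgt])])"

definition tagged_omega1 :: "bintree \<Rightarrow> (letter \<times> position) list" where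
  "tagged_omega1 T = filter (\<lambda>(c, _). c \<noteq> One \<and> c \<noteq> Two) (tagged_omega T)"

lemma map_fst_tagged_omega: "map fst (tagged_omega T) = omega T"
  by (induction T) (simp_all add: case_prod_beta comp_def)

lemma omega1_eq_tagged: "omega1 T = map (\<lambda>(c, _). step_of c) (tagged_omega1 T)"
  by (simp add: omega1_def tagged_omega1_def filter_map comp_def case_prod_unfold
      flip: map_fst_tagged_omega)

fun subtree_at :: "bintree \<Rightarrow> position \<Rightarrow> bintree" where
  "subtree_at T [] = T"
| "subtree_at \<langle>\<rangle> (_ # _) = \<langle>\<rangle>"
| "subtree_at \<langle>l, _, _\<rangle> (Lft # p) = subtree_at l p"
| "subtree_at \<langle>_, _, r\<rangle> (Rgt # p) = subtree_at r p"

text \<open>Replaces the subtree at a position. If the node there has no children, this glues the root of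
  the new tree onto that node.\<close>

fun graft :: "bintree \<Rightarrow> position \<Rightarrow> bintree \<Rightarrow> bintree" where
  "graft T [] S = S"
| "graft \<langle>\<rangle> (_ # _) S = \<langle>\<rangle>"
| "graft \<langle>l, v, r\<rangle> (Lft # p) S = \<langle>graft l p S, v, r\<rangle>"
| "graft \<langle>l, v, r\<rangle> (Rgt # p) S = \<langle>l, v, graft r p S\<rangle>"

text \<open>Removes everything below the node at a position and keeps that node.\<close>

abbreviation prune :: "bintree \<Rightarrow> position \<Rightarrow> bintree" where
  "prune T p \<equiv> graft T p single"

fun leftmost_leaf :: "bintree \<Rightarrow> position" where
  "leftmost_leaf \<langle>\<rangle> = []"
| "leftmost_leaf \<langle>l, _, r\<rangle> =
     (if l \<noteq> \<langle>\<rangle> then Lft # leftmost_leaf l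
      else if r \<noteq> \<langle>\<rangle> then Rgt # leftmost_leaf r
      else [])"

definition attach_leftmost :: "bintree \<Rightarrow> bintree \<Rightarrow> bintree" where
  "attach_leftmost T S = graft T (leftmost_leaf T) S"


section \<open>The tree of a path\<close>

fun left_chain :: "nat \<Rightarrow> bintree" where
  "left_chain 0 = single"
| "left_chain (Suc i) = \<langle>left_chain i, (), \<langle>\<rangle>\<rangle>"

fun right_chain :: "nat \<Rightarrow> bintree" where
  "right_chain 0 = single"
| "right_chain (Suc j) = \<langle>\<langle>\<rangle>, (), right_chain j\<rangle>"

text \<open>The chain of left edges and the chain of right edges share their root.\<close>

definition block_tree :: "nat \<Rightarrow> nat \<Rightarrow> bintree" where
  "block_tree i j = \<langle>left (left_chain i), (), right (right_chain j)\<rangle>"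

text \<open>The exponents \<open>(i\<^sub>1, j\<^sub>1), \<dots>, (i\<^sub>r, j\<^sub>r)\<close> of the factorisation of a path into maximal blocks
  \<open>N\<^sup>i E\<^sup>j\<close>.\<close>

function blocks :: "path \<Rightarrow> (nat \<times> nat) list" where
  "blocks [] = []"
| "blocks (s # P) =
     (let P' = dropWhile (\<lambda>t. t = N) (s # P)
      in (length (takeWhile (\<lambda>t. t = N) (s # P)), length (takeWhile (\<lambda>t. t = E) P'))
           # blocks (dropWhile (\<lambda>t. t = E) P'))"
  by pat_completeness auto
termination
proof (relation "measure length")
  fix s :: step and P P' :: path
  assume P': "P' = dropWhile (\<lambda>t. t = N) (s # P)"
  have le: "length (dropWhile p xs) \<le> length xs" for p and xs :: path
    by (rule length_dropWhile_le)
  have "length (dropWhile (\<lambda>t. t = E) P') < length (s # P)"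
  proof (cases s)
    case N
    then have "length P' \<le> length P"
      using P' le by simp
    with le[of "\<lambda>t. t = E" P'] show ?thesis
      by simp
  next
    case E
    then have "dropWhile (\<lambda>t. t = E) P' = dropWhile (\<lambda>t. t = E) P"
      using P' by simp
    with le[of "\<lambda>t. t = E" P] show ?thesis
      by simp
  qed
  then show "(dropWhile (\<lambda>t. t = E) P', s # P) \<in> measure length"
    by simp
qed simp

definition Tr :: "path \<Rightarrow> bintree" where
  "Tr P = foldl (\<lambda>T (i, j). attach_leftmost (block_tree i j) T) single (blocks P)"


section \<open>Rotations\<close>

text \<open>Letters are counted from \<open>0\<close>, so that \<open>k\<^sub>2 = length R\<close> if \<open>R\<close> has no \<open>N\<close> after \<open>k\<^sub>1\<close>.
  The node \<open>x\<close> is the root of \<open>Tr'\<close> in \<open>T\<close>; the edge \<open>e\<^sub>0\<close> is at position \<open>d\<close> within \<open>B\<^sub>t\<close>. The premise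
  on \<^term>\<open>tagged_omega1\<close> of \<open>Tr'\<close> says that \<open>Tr'\<close> consists of exactly the edges of \<open>T\<close> whose letters
  are at the places \<open>k\<^sub>1, \<dots>, k\<^sub>2 - 1\<close> of the first word of \<open>T\<close>.\<close>

inductive rotation :: "path \<Rightarrow> path \<times> bintree \<Rightarrow> path \<times> bintree \<Rightarrow> bool" for Q :: path where
  rotation:
  "rotation Q (R, T) (R\<^sub>1, T\<^sub>1)"
  if "k\<^sub>0 < length R" "R ! k\<^sub>0 \<noteq> Q ! k\<^sub>0" "\<forall>k<k\<^sub>0. R ! k = Q ! k"
    and "k\<^sub>0 < k\<^sub>1" "k\<^sub>1 < length R" "R ! k\<^sub>1 = N" "\<forall>k. k\<^sub>0 < k \<and> k < k\<^sub>1 \<longrightarrow> R ! k \<noteq> N"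
    and "k\<^sub>1 < k\<^sub>2" "k\<^sub>2 \<le> length R" "k\<^sub>2 = length R \<or> R ! k\<^sub>2 = N"
        "\<forall>k. k\<^sub>1 < k \<and> k < k\<^sub>2 \<longrightarrow> R ! k \<noteq> N"
    and "k\<^sub>0 < length (tagged_omega1 T)" "tagged_omega1 T ! k\<^sub>0 = (TwoBar, e\<^sub>0)"
    and "B\<^sub>r = prune T x"
    and "Tr' = prune (subtree_at T x) [Lft]"
        "Tr' = \<langle>single, (), right (right_chain (k\<^sub>2 - k\<^sub>1 - 1))\<rangle>"
        "take (k\<^sub>2 - k\<^sub>1) (drop k\<^sub>1 (tagged_omega1 T)) = map (\<lambda>(c, p). (c, x @ p)) (tagged_omega1 Tr')"
    and "B\<^sub>t = subtree_at T (x @ [Lft])"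
    and "e\<^sub>0 = x @ [Lft] @ d" "B\<^sub>t\<^sub>0 = prune B\<^sub>t d" "B\<^sub>t\<^sub>1 = subtree_at B\<^sub>t d"
    and "T\<^sub>1 = attach_leftmost B\<^sub>r (graft B\<^sub>t\<^sub>0 d (attach_leftmost Tr' B\<^sub>t\<^sub>1))"
    and "R\<^sub>1 = take k\<^sub>0 R @ take (k\<^sub>2 - k\<^sub>1) (drop k\<^sub>1 R) @ take (k\<^sub>1 - k\<^sub>0) (drop k\<^sub>0 R) @ drop k\<^sub>2 R"

text \<open>The tree \<open>B(Q, P)\<close>. The description determines a tree only if successive rotations do lead from
  \<open>P\<close> to \<open>Q\<close>, and all such sequences of rotations end with the same tree.\<close>

definition B_tree :: "path \<Rightarrow> path \<Rightarrow> bintree" where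
  "B_tree Q P = (THE T. (rotation Q)\<^sup>*\<^sup>* (P, Tr P) (Q, T))"

end

theory Submission
  imports Defs
begin

text \<open>
  Throughout the rotations the part of the tree that has not been touched yet keeps the shape it
  has in \<^term>\<open>Tr P\<close>: a spine of left edges, each with a chain of right edges hanging from its upper
  end. Hence every tree that occurs is \<open>spine U ms\<close>, where \<open>U\<close> is the reworked part, glued to the lower
  end of the spine, and \<open>ms\<close> are the lengths of the chains, read upwards. Both words of such a tree are
  the respective word of \<open>U\<close> followed by the same word \<open>spine_word ms\<close>.

  Let \<open>R = A E\<^sup>c N E\<^sup>m W\<close> be the path before a rotation, where \<open>A\<close> is its longest common prefix with \<open>Q\<close> and
  the displayed \<open>N\<close> is the letter \<open>k\<^sub>1\<close>. The invariant puts this \<open>N\<close> on the spine, so the first word of \<open>B\<^sub>t\<close> is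
  \<open>A E\<^sup>c\<close>. A final run of \<open>c\<close> letters \<open>E\<close> in a first word can come only from right edges on the path
  that goes right from the root all the time, because climbing a left edge would produce an \<open>N\<close>
  (\<open>final_E_run\<close>). So \<open>e\<^sub>0\<close> is the \<open>c\<close>-th edge of that path, and grafting \<open>Tr'\<close>
  there inserts \<open>N E\<^sup>m\<close> into the first word before the \<open>c\<close> closing letters \<open>E\<close>. In the second word the
  edges of that path are recorded on the way down, so nothing is recorded after the graft and
  \<open>N E\<^sup>m\<close> is appended at the end (\<open>words_graft_Rgt\<close>). It was removed from exactly that place, whence the
  second word does not change (\<open>rotation_step\<close>).

  Each rotation lengthens the common prefix with \<open>Q\<close> and keeps the path weakly below \<open>Q\<close>, so the path
  \<open>Q\<close> is reached (\<open>rotations_reach\<close>). As the paths and the first word determine the cut of the tree, rotation is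
  a partial function (\<open>rotation_right_unique\<close>), and no rotation starts at \<open>Q\<close>. This identifies the tree
  that is reached with \<^term>\<open>B_tree Q P\<close>.
\<close>

section \<open>Words of trees\<close>

lemma omega1_Leaf [simp]: "omega1 \<langle>\<rangle> = []"
  and omega1_Node [simp]: "omega1 \<langle>l, u, r\<rangle> =
    (if l = \<langle>\<rangle> then [] else omega1 l @ [N]) @ (if r = \<langle>\<rangle> then [] else omega1 r @ [E])"
  by (simp_all add: omega1_def)

lemma omega2_Leaf [simp]: "omega2 \<langle>\<rangle> = []"
  and omega2_Node [simp]: "omega2 \<langle>l, u, r\<rangle> =
    (if l = \<langle>\<rangle> then [] else omega2 l @ [N]) @ (if r = \<langle>\<rangle> then [] else E # omega2 r)"
  by (simp_all add: omega2_def)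

lemma tagged_omega1_Leaf [simp]: "tagged_omega1 \<langle>\<rangle> = []"
  and tagged_omega1_Node [simp]: "tagged_omega1 \<langle>l, u, r\<rangle> =
    (if l = \<langle>\<rangle> then [] else map (\<lambda>(c, p). (c, Lft # p)) (tagged_omega1 l) @ [(OneBar, [Lft])]) @
    (if r = \<langle>\<rangle> then [] else map (\<lambda>(c, p). (c, Rgt # p)) (tagged_omega1 r) @ [(TwoBar, [Rgt])])"
  by (simp_all add: tagged_omega1_def filter_map comp_def case_prod_unfold)

lemma length_tagged_omega1: "length (tagged_omega1 T) = length (omega1 T)"
  by (simp add: omega1_eq_tagged)

lemma right_chain_not_Leaf [simp]: "right_chain m \<noteq> \<langle>\<rangle>"
  by (cases m) simp_all

lemma omega1_right_chain: "omega1 (right_chain m) = replicate m E"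
  and omega2_right_chain: "omega2 (right_chain m) = replicate m E"
  by (induction m) (simp_all add: replicate_append_same)

lemma omega_right_right_chain [simp]:
  "(if right (right_chain m) = \<langle>\<rangle> then [] else omega1 (right (right_chain m)) @ [E]) = replicate m E"
  "(if right (right_chain m) = \<langle>\<rangle> then [] else E # omega2 (right (right_chain m))) = replicate m E"
  using omega1_right_chain[of m] omega2_right_chain[of m] by (cases m; simp)+


section \<open>Spines\<close>

definition spine :: "bintree \<Rightarrow> nat list \<Rightarrow> bintree" where
  "spine U ms = foldl (\<lambda>T m. \<langle>T, (), right (right_chain m)\<rangle>) U ms"

definition spine_word :: "nat list \<Rightarrow> path" where
  "spine_word ms = concat (map (\<lambda>m. N # replicate m E) ms)"

lemma spine_simps [simp]:
  "spine U [] = U"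
  "spine U (m # ms) = spine \<langle>U, (), right (right_chain m)\<rangle> ms"
  "spine U (ms @ [m]) = \<langle>spine U ms, (), right (right_chain m)\<rangle>"
  by (simp_all add: spine_def)

lemma spine_append: "spine U (ms @ ms') = spine (spine U ms) ms'"
  by (simp add: spine_def)

lemma spine_word_simps [simp]:
  "spine_word [] = []"
  "spine_word (m # ms) = N # replicate m E @ spine_word ms"
  "spine_word (ms @ ms') = spine_word ms @ spine_word ms'"
  by (simp_all add: spine_word_def)

lemma spine_not_Leaf [simp]: "U \<noteq> \<langle>\<rangle> \<Longrightarrow> spine U ms \<noteq> \<langle>\<rangle>"
  by (induction ms arbitrary: U) simp_all

lemma omega1_spine: "U \<noteq> \<langle>\<rangle> \<Longrightarrow> omega1 (spine U ms) = omega1 U @ spine_word ms"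
  by (induction ms arbitrary: U) simp_all

lemma omega2_spine: "U \<noteq> \<langle>\<rangle> \<Longrightarrow> omega2 (spine U ms) = omega2 U @ spine_word ms"
  by (induction ms arbitrary: U) simp_all

lemma tagged_omega1_spine:
  assumes "U \<noteq> \<langle>\<rangle>"
  shows "\<exists>rest. tagged_omega1 (spine U ms) =
    map (\<lambda>(c, p). (c, replicate (length ms) Lft @ p)) (tagged_omega1 U) @ rest"
proof (induction ms rule: rev_induct)
  case (snoc m ms)
  then show ?case
    using assms by (auto simp: comp_def case_prod_unfold)
qed simp

lemma subtree_at_Leaf [simp]: "subtree_at \<langle>\<rangle> p = \<langle>\<rangle>"
  by (cases p) simp_all

lemma subtree_at_append: "subtree_at T (p @ q) = subtree_at (subtree_at T p) q"
  by (induction T p rule: subtree_at.induct) simp_all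

lemma subtree_at_spine: "subtree_at (spine U ms) (replicate (length ms) Lft) = U"
  by (induction ms rule: rev_induct) simp_all

lemma graft_spine: "graft (spine U ms) (replicate (length ms) Lft) S = spine S ms"
  by (induction ms rule: rev_induct) simp_all

lemma leftmost_leaf_spine_single: "leftmost_leaf (spine single ms) = replicate (length ms) Lft"
  by (induction ms rule: rev_induct) simp_all

lemma attach_leftmost_spine_single: "attach_leftmost (spine single ms) S = spine S ms"
  by (simp add: attach_leftmost_def leftmost_leaf_spine_single graft_spine)

lemma graft_graft: "graft (graft T p S) p S' = graft T p S'"
  by (induction T p S rule: graft.induct) simp_all

lemma graft_subtree_at: "graft T p (subtree_at T p) = T"
  by (induction T p rule: subtree_at.induct) simp_all

lemma replicate_E_append_eq_append_N:
  assumes "replicate m E @ W = X @ N # Y"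
  obtains Z where "X = replicate m E @ Z" and "W = Z @ N # Y"
proof -
  from assms obtain us where
    "replicate m E = X @ us \<and> us @ W = N # Y \<or> replicate m E @ us = X \<and> W = us @ N # Y"
    unfolding append_eq_append_conv2 by blast
  moreover have "us = []" if us: "replicate m E = X @ us" "us @ W = N # Y"
  proof (rule ccontr)
    assume "us \<noteq> []"
    with us(2) have "N \<in> set us"
      by (cases us) auto
    with arg_cong[OF us(1), of set] show False
      by (auto split: if_splits)
  qed
  ultimately show ?thesis
    using that by (metis append_Nil append_Nil2)
qed

lemma spine_word_split:
  assumes "spine_word ms = X @ N # Y"
  shows "\<exists>ms1 m ms2. ms = ms1 @ m # ms2 \<and> X = spine_word ms1 \<and> Y = replicate m E @ spine_word ms2"
  using assms
proof (induction ms arbitrary: X)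
  case (Cons m ms)
  show ?case
  proof (cases X)
    case Nil
    then show ?thesis
      using Cons.prems by (metis append_Nil list.inject spine_word_simps(1,2))
  next
    case (Cons s X')
    then have X: "X = N # X'" and eq: "replicate m E @ spine_word ms = X' @ N # Y"
      using Cons.prems by auto
    from eq obtain X'' where X'': "X' = replicate m E @ X''" "spine_word ms = X'' @ N # Y"
      by (rule replicate_E_append_eq_append_N)
    from Cons.IH[OF X''(2)] obtain ms1 k ms2 where
      "ms = ms1 @ k # ms2" "X'' = spine_word ms1" "Y = replicate k E @ spine_word ms2"
      by blast
    then show ?thesis
      using X X''(1) by (intro exI[of _ "m # ms1"] exI[of _ k] exI[of _ ms2]) simp
  qed
qed simp

lemma left_chain_not_Leaf [simp]: "left_chain i \<noteq> \<langle>\<rangle>"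
  by (cases i) simp_all

lemma attach_leftmost_block_tree:
  "attach_leftmost (block_tree (Suc i) j) T = spine T (replicate i 0 @ [j])"
proof -
  have "graft (left_chain i) (leftmost_leaf (left_chain i)) T = spine T (replicate i 0)"
  proof (induction i)
    case (Suc i)
    have "replicate (Suc i) (0 :: nat) = replicate i 0 @ [0]"
      by (simp add: replicate_append_same)
    then show ?case
      using Suc by (simp del: replicate_Suc)
  qed simp
  then show ?thesis
    by (simp add: attach_leftmost_def block_tree_def)
qed

text \<open>The blocks \<open>N\<^sup>i E\<^sup>j\<close> contribute \<open>i - 1\<close> spine edges without a chain and one with a chain of length
  \<open>j\<close>. Without an initial \<open>N\<close> the first block would be a bare chain of right edges and the tree would not
  be a spine.\<close>

lemma Tr_blocks_spine:
  assumes "P = [] \<or> hd P = N"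
  shows "\<exists>ms. spine_word ms = P \<and>
    (\<forall>T. foldl (\<lambda>T (i, j). attach_leftmost (block_tree i j) T) T (blocks P) = spine T ms)"
  using assms
proof (induction P rule: blocks.induct)
  case 1
  then show ?case
    by (intro exI[of _ "[]"]) simp
next
  case (2 s P)
  then have s: "s = N"
    by simp
  define i where "i = length (takeWhile (\<lambda>t. t = N) P)"
  define P' where "P' = dropWhile (\<lambda>t. t = N) P"
  define j where "j = length (takeWhile (\<lambda>t. t = E) P')"
  define P'' where "P'' = dropWhile (\<lambda>t. t = E) P'"
  have run: "takeWhile (\<lambda>t. t = x) xs = replicate (length (takeWhile (\<lambda>t. t = x) xs)) x"
    for x :: step and xs
    by (rule replicate_length_same[symmetric]) (auto dest: set_takeWhileD)
  have P: "P = replicate i N @ replicate j E @ P''"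
    unfolding i_def j_def P'_def P''_def run[symmetric] by simp
  have blocks: "blocks (s # P) = (Suc i, j) # blocks P''"
    using s by (simp add: Let_def i_def j_def P'_def P''_def)
  have "P'' = [] \<or> hd P'' = N"
    using hd_dropWhile[of "\<lambda>t. t = E" P'] by (cases "hd P''") (auto simp: P''_def)
  then obtain ms where ms: "spine_word ms = P''"
    "foldl (\<lambda>T (i, j). attach_leftmost (block_tree i j) T) T (blocks P'') = spine T ms" for T
    using "2.IH" s by (auto simp: P'_def P''_def)
  have "spine_word (replicate i 0) = replicate i N"
    by (induction i) simp_all
  moreover have "foldl (\<lambda>T (i, j). attach_leftmost (block_tree i j) T) T (blocks (s # P)) =
      spine T (replicate i 0 @ [j] @ ms)" for T
    unfolding blocks by (simp add: ms(2) attach_leftmost_block_tree spine_append)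
  ultimately show ?case
    using s P ms(1)
    by (intro exI[of _ "replicate i 0 @ [j] @ ms"])
       (simp add: replicate_app_Cons_same del: blocks.simps)
qed


section \<open>Grafting along the path of right edges\<close>

text \<open>The induction peels off the root. Removing the closing letter of its right edge shortens the
  run by one; what its left edge contributes is empty or ends with \<open>N\<close>, so it cannot take part in the
  run.\<close>

lemma final_E_run:
  assumes "U \<noteq> \<langle>\<rangle>" and "omega1 U = A @ replicate c E"
  shows "subtree_at U (replicate c Rgt) \<noteq> \<langle>\<rangle>"
  using assms
proof (induction U arbitrary: A c)
  case (Node l u r)
  show ?case
  proof (cases c)
    case (Suc c')
    define L where "L = (if l = \<langle>\<rangle> then [] else omega1 l @ [N])"
    have eq: "L @ (if r = \<langle>\<rangle> then [] else omega1 r @ [E]) = (A @ replicate c' E) @ [E]"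
      using Node.prems(2) Suc by (simp add: L_def replicate_append_same)
    have r: "r \<noteq> \<langle>\<rangle>"
    proof
      assume "r = \<langle>\<rangle>"
      with eq have "L = (A @ replicate c' E) @ [E]"
        by simp
      then show False
        by (auto simp: L_def split: if_splits)
    qed
    with eq have "L @ omega1 r = A @ replicate c' E"
      by simp
    then obtain us where
      "L = A @ us \<and> us @ omega1 r = replicate c' E \<or> L @ us = A \<and> omega1 r = us @ replicate c' E"
      by (auto simp: append_eq_append_conv2)
    moreover have "us = []" if us: "L = A @ us" "us @ omega1 r = replicate c' E"
    proof (rule ccontr)
      assume "us \<noteq> []"
      with us(1) have "N \<in> set us"
        by (cases us rule: rev_cases) (auto simp: L_def split: if_splits)
      with arg_cong[OF us(2), of set] show False
        by (auto split: if_splits)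
    qed
    ultimately obtain A' where "omega1 r = A' @ replicate c' E"
      by fastforce
    from Node.IH(2)[OF r this] Suc show ?thesis
      by simp
  qed simp
qed simp

text \<open>The edges of the path of right edges are closed in the first word after everything below the
  graft, innermost edge first; in the second word they are recorded when they are entered.\<close>

lemma words_graft_Rgt:
  assumes "subtree_at U (replicate c Rgt) \<noteq> \<langle>\<rangle>"
  shows "\<exists>X Z. \<forall>S. S \<noteq> \<langle>\<rangle> \<longrightarrow>
    graft U (replicate c Rgt) S \<noteq> \<langle>\<rangle> \<and>
    tagged_omega1 (graft U (replicate c Rgt) S) =
      X @ map (\<lambda>(l, p). (l, replicate c Rgt @ p)) (tagged_omega1 S) @
      map (\<lambda>i. (TwoBar, replicate i Rgt)) (rev [1..<Suc c]) \<and>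
    omega2 (graft U (replicate c Rgt) S) = Z @ omega2 S"
  using assms
proof (induction c arbitrary: U)
  case 0
  then show ?case
    by (auto simp: case_prod_unfold)
next
  case (Suc c)
  then obtain l u r where U: "U = \<langle>l, u, r\<rangle>"
    by (cases U) auto
  with Suc obtain X Z where XZ: "S \<noteq> \<langle>\<rangle> \<Longrightarrow>
    graft r (replicate c Rgt) S \<noteq> \<langle>\<rangle> \<and>
    tagged_omega1 (graft r (replicate c Rgt) S) =
      X @ map (\<lambda>(l, p). (l, replicate c Rgt @ p)) (tagged_omega1 S) @
      map (\<lambda>i. (TwoBar, replicate i Rgt)) (rev [1..<Suc c]) \<and>
    omega2 (graft r (replicate c Rgt) S) = Z @ omega2 S" for S
    by (metis replicate_Suc subtree_at.simps(4))
  have shift: "map (\<lambda>i. (TwoBar, replicate i Rgt)) (rev [1..<Suc (Suc c)]) =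
    map (\<lambda>(c, p). (c, Rgt # p)) (map (\<lambda>i. (TwoBar, replicate i Rgt)) (rev [1..<Suc c])) @
    [(TwoBar, [Rgt])]"
    by (simp add: upt_conv_Cons map_Suc_upt[symmetric] rev_map comp_def del: upt_Suc)
  show ?case
    unfolding shift
    by (rule exI[of _ "(if l = \<langle>\<rangle> then [] else
            map (\<lambda>(c, p). (c, Lft # p)) (tagged_omega1 l) @ [(OneBar, [Lft])]) @
          map (\<lambda>(c, p). (c, Rgt # p)) X"],
        rule exI[of _ "(if l = \<langle>\<rangle> then [] else omega2 l @ [N]) @ E # Z"])
       (simp add: U XZ case_prod_unfold comp_def del: upt_Suc)
qed


section \<open>A single rotation\<close>

lemma rotation_step:
  assumes U: "U \<noteq> \<langle>\<rangle>" "omega1 U = A @ replicate c E" and c: "c > 0" and Q: "Q = A @ N # D"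
  shows "\<exists>U'. U' \<noteq> \<langle>\<rangle> \<and> omega1 U' = (A @ [N]) @ replicate (m + c) E \<and>
    omega2 U' = omega2 U @ N # replicate m E \<and>
    rotation Q (omega1 U @ spine_word (m # ms), spine U (m # ms))
      (omega1 U' @ spine_word ms, spine U' ms)"
proof -
  define d where "d = replicate c Rgt"
  define V where "V = subtree_at U d"
  define Tr' where "Tr' = \<langle>single, (), right (right_chain m)\<rangle>"
  define S where "S = \<langle>V, (), right (right_chain m)\<rangle>"
  define U' where "U' = graft U d S"
  define x where "x = replicate (length ms) Lft"
  define T where "T = spine U (m # ms)"
  define R where "R = omega1 U @ spine_word (m # ms)"
  let ?k0 = "length A" and ?k1 = "length A + c" and ?k2 = "length A + c + Suc m"
  have V: "V \<noteq> \<langle>\<rangle>"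
    using final_E_run[OF U] by (simp add: V_def d_def)
  obtain X Z where graft: "W \<noteq> \<langle>\<rangle> \<Longrightarrow> graft U d W \<noteq> \<langle>\<rangle>"
    and tagged: "W \<noteq> \<langle>\<rangle> \<Longrightarrow> tagged_omega1 (graft U d W) =
      X @ map (\<lambda>(l, p). (l, d @ p)) (tagged_omega1 W) @
      map (\<lambda>i. (TwoBar, replicate i Rgt)) (rev [1..<Suc c])"
    and omega2: "W \<noteq> \<langle>\<rangle> \<Longrightarrow> omega2 (graft U d W) = Z @ omega2 W" for W
    using words_graft_Rgt[of U c] V unfolding V_def d_def by metis
  have E: "map (\<lambda>(l, p). step_of l) (map (\<lambda>i. (TwoBar, replicate i Rgt)) (rev [1..<Suc c])) =
      replicate c E"
    by (simp add: comp_def map_replicate_const del: upt_Suc)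
  have omega1: "omega1 (graft U d W) =
      map (\<lambda>(l, p). step_of l) X @ omega1 W @ replicate c E" if "W \<noteq> \<langle>\<rangle>" for W
    unfolding omega1_eq_tagged tagged[OF that] map_append E by (simp add: comp_def case_prod_unfold)
  have UV: "graft U d V = U"
    by (simp add: V_def graft_subtree_at)
  have A: "A = map (\<lambda>(l, p). step_of l) X @ omega1 V"
    using omega1[OF V] U(2) by (simp add: UV)
  have S: "S \<noteq> \<langle>\<rangle>" "omega1 S = omega1 V @ N # replicate m E" "omega2 S = omega2 V @ N # replicate m E"
    using V by (simp_all add: S_def)
  have U': "U' \<noteq> \<langle>\<rangle>" "omega1 U' = (A @ [N]) @ replicate (m + c) E"
    "omega2 U' = omega2 U @ N # replicate m E"
    using graft[OF S(1)] omega1[OF S(1)] omega2[OF S(1)] omega2[OF V] S(2,3)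
    by (simp_all add: U'_def UV A replicate_add)
  have R: "R = A @ replicate c E @ N # replicate m E @ spine_word ms"
    by (simp add: R_def U(2))
  \<comment> \<open>The first of the final \<open>c\<close> letters of \<open>U\<close> belongs to the innermost edge of its path of right edges.\<close>
  have tagged_U: "length (tagged_omega1 U) = ?k1" "tagged_omega1 U ! ?k0 = (TwoBar, d)"
  proof -
    show len: "length (tagged_omega1 U) = ?k1"
      by (simp add: length_tagged_omega1 U(2))
    define Y where "Y = X @ map (\<lambda>(l, p). (l, d @ p)) (tagged_omega1 V)"
    have "tagged_omega1 U = Y @ map (\<lambda>i. (TwoBar, replicate i Rgt)) (rev [1..<Suc c])"
      using tagged[OF V] by (simp add: UV Y_def del: upt_Suc)
    moreover from this have "length Y = ?k0"
      using len by (simp del: upt_Suc)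
    ultimately show "tagged_omega1 U ! ?k0 = (TwoBar, d)"
      using c by (simp add: nth_append d_def)
  qed
  obtain rest where rest: "tagged_omega1 T =
      map (\<lambda>(l, p). (l, x @ p)) (tagged_omega1 \<langle>U, (), right (right_chain m)\<rangle>) @ rest"
    using tagged_omega1_spine[of "\<langle>U, (), right (right_chain m)\<rangle>" ms] by (auto simp: T_def x_def)
  have omega1_Tr': "omega1 Tr' = N # replicate m E"
    by (simp add: Tr'_def)
  have node: "tagged_omega1 \<langle>U, (), right (right_chain m)\<rangle> =
      map (\<lambda>(l, p). (l, Lft # p)) (tagged_omega1 U) @ tagged_omega1 Tr'"
    using U(1) by (simp add: Tr'_def)
  have tagged_T: "tagged_omega1 T = map (\<lambda>(l, p). (l, x @ Lft # p)) (tagged_omega1 U) @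
      map (\<lambda>(l, p). (l, x @ p)) (tagged_omega1 Tr') @ rest"
    unfolding rest node by (simp add: comp_def case_prod_unfold)
  have len_Tr': "length (tagged_omega1 Tr') = Suc m"
    by (simp add: length_tagged_omega1 omega1_Tr')
  have sub: "subtree_at T x = \<langle>U, (), right (right_chain m)\<rangle>"
    using subtree_at_spine[of "\<langle>U, (), right (right_chain m)\<rangle>" ms] by (simp add: T_def x_def)
  have "rotation Q (R, T) (omega1 U' @ spine_word ms, spine U' ms)"
  proof (rule rotation.rotation[where k\<^sub>0 = ?k0 and k\<^sub>1 = ?k1 and k\<^sub>2 = ?k2 and e\<^sub>0 = "x @ [Lft] @ d"
        and x = x and d = d and Tr' = Tr' and B\<^sub>r = "spine single ms" and B\<^sub>t = U
        and B\<^sub>t\<^sub>0 = "prune U d" and B\<^sub>t\<^sub>1 = V])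
    show "?k0 < length (tagged_omega1 T)" "tagged_omega1 T ! ?k0 = (TwoBar, x @ [Lft] @ d)"
      using c by (simp_all add: tagged_T tagged_U nth_append)
    show "spine single ms = prune T x"
      using graft_spine[of "\<langle>U, (), right (right_chain m)\<rangle>" ms] by (simp add: T_def x_def)
    show "Tr' = prune (subtree_at T x) [Lft]"
      by (simp add: sub Tr'_def)
    show "Tr' = \<langle>single, (), right (right_chain (?k2 - ?k1 - 1))\<rangle>"
      by (simp add: Tr'_def)
    show "take (?k2 - ?k1) (drop ?k1 (tagged_omega1 T)) =
        map (\<lambda>(c, p). (c, x @ p)) (tagged_omega1 Tr')"
      by (simp add: tagged_T tagged_U len_Tr')
    show "U = subtree_at T (x @ [Lft])"
      by (simp add: subtree_at_append sub)
    show "spine U' ms = attach_leftmost (spine single ms)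
        (graft (prune U d) d (attach_leftmost Tr' V))"
      by (simp add: attach_leftmost_spine_single graft_graft U'_def S_def)
         (simp add: attach_leftmost_def Tr'_def)
    show "R ! ?k1 = N" "\<forall>k. ?k0 < k \<and> k < ?k1 \<longrightarrow> R ! k \<noteq> N"
      "\<forall>k. ?k1 < k \<and> k < ?k2 \<longrightarrow> R ! k \<noteq> N"
      by (auto simp: R nth_append nth_Cons')
    show "?k2 = length R \<or> R ! ?k2 = N"
      by (cases ms) (auto simp: R nth_append)
    show "omega1 U' @ spine_word ms = take ?k0 R @ take (?k2 - ?k1) (drop ?k1 R) @
        take (?k1 - ?k0) (drop ?k0 R) @ drop ?k2 R"
      by (simp add: R U'(2) replicate_add)
    show "R ! ?k0 \<noteq> Q ! ?k0"
      using c by (simp add: R Q nth_append)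
  qed (use c in \<open>auto simp: R Q V_def nth_append\<close>)
  then show ?thesis
    using U' unfolding R_def T_def by blast
qed

text \<open>The indices depend on the two paths alone, and the left edge of \<open>Tr'\<close> has the letter at \<open>k\<^sub>1\<close>, which
  fixes \<open>x\<close>.\<close>

lemma rotation_right_unique:
  assumes "rotation Q s t" and "rotation Q s t'"
  shows "t = t'"
  using assms(1)
proof cases
  case 1: (rotation k\<^sub>0 R k\<^sub>1 k\<^sub>2 T e\<^sub>0 B\<^sub>r x Tr' B\<^sub>t d B\<^sub>t\<^sub>0 B\<^sub>t\<^sub>1 T\<^sub>1 R\<^sub>1)
  from assms(2) show ?thesis
  proof cases
    case 2: (rotation k\<^sub>0' R' k\<^sub>1' k\<^sub>2' T' e\<^sub>0' B\<^sub>r' x' Tr'' B\<^sub>t' d' B\<^sub>t\<^sub>0' B\<^sub>t\<^sub>1' T\<^sub>1' R\<^sub>1')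
    have s: "R' = R" "T' = T"
      using 1 2 by simp_all
    have k0: "k\<^sub>0' = k\<^sub>0"
      using 1(4,5) 2(4,5) unfolding s by (metis nat_neq_iff)
    have k1: "k\<^sub>1' = k\<^sub>1"
      using 1(6,8,9) 2(6,8,9) unfolding s k0 by (metis nat_neq_iff)
    have k2: "k\<^sub>2' = k\<^sub>2"
      using 1(10-13) 2(10-13) unfolding s k1 by (metis nat_neq_iff not_less)
    have place: "drop k\<^sub>1 (tagged_omega1 T) \<noteq> [] \<and> hd (drop k\<^sub>1 (tagged_omega1 T)) = (OneBar, y @ [Lft])"
      if "B = \<langle>single, (), r\<rangle>"
        "take k (drop k\<^sub>1 (tagged_omega1 T)) = map (\<lambda>(c, p). (c, y @ p)) (tagged_omega1 B)"
      for B r k y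
      using that by (cases "drop k\<^sub>1 (tagged_omega1 T)"; cases k) auto
    have x: "x' = x"
      using place[OF 1(18,19)] place[OF 2(18,19)[unfolded s k1]] by simp
    have e0: "e\<^sub>0' = e\<^sub>0"
      using 1(15) 2(15) unfolding s k0 by simp
    have d: "d' = d"
      using 1(21) 2(21) unfolding x e0 by simp
    show ?thesis
      using 1 2 unfolding s k0 k1 k2 x d by simp
  qed
qed

lemma no_rotation_from_target: "\<not> rotation Q (Q, T) t"
  by (auto elim: rotation.cases)


section \<open>The sequence of rotations\<close>

text \<open>The Young order in terms of prefixes, which behave well under exchanging factors: a path is
  weakly below another one if none of its prefixes contains more north steps.\<close>

definition prefix_dominated :: "path \<Rightarrow> path \<Rightarrow> bool" where
  "prefix_dominated R Q \<longleftrightarrow> (\<forall>k. count_list (take k R) N \<le> count_list (take k Q) N)"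

lemma step_sequence_Nil [simp]: "step_sequence [] = []"
  by (simp add: step_sequence_def)

lemma filter_upt_Suc_map:
  "filter p [0..<Suc n] = (if p 0 then [0] else []) @ map Suc (filter (\<lambda>k. p (Suc k)) [0..<n])"
  by (simp add: upt_conv_Cons filter_map comp_def map_Suc_upt[symmetric] del: upt_Suc)

lemma step_sequence_Cons [simp]:
  "step_sequence (N # P) = 0 # step_sequence P"
  "step_sequence (E # P) = map Suc (step_sequence P)"
  by (simp_all add: step_sequence_def filter_upt_Suc_map comp_def del: upt_Suc)

text \<open>The north step with index \<open>i\<close> is preceded by \<open>i\<close> north steps and \<open>step_sequence P ! i\<close> east steps.\<close>

lemma less_count_take_iff:
  "i < count_list (take k P) N \<longleftrightarrow> i < length (step_sequence P) \<and> step_sequence P ! i + i < k"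
proof (induction P arbitrary: i k)
  case (Cons s P)
  show ?case
  proof (cases k)
    case (Suc k')
    show ?thesis
    proof (cases s)
      case N
      with Suc Cons.IH[of "i - 1" k'] show ?thesis
        by (cases i) simp_all
    next
      case E
      with Suc Cons.IH[of i k'] show ?thesis
        by (cases "i < length (step_sequence P)") simp_all
    qed
  qed simp
qed simp

lemma young_le_prefix_dominated:
  assumes "P \<le>\<^sub>Y Q"
  shows "prefix_dominated P Q"
  unfolding prefix_dominated_def
proof (intro allI)
  fix k
  have len: "length (step_sequence Q) = length (step_sequence P)"
    and le: "\<And>i. i < length (step_sequence Q) \<Longrightarrow> step_sequence Q ! i \<le> step_sequence P ! i"
    using assms by (auto simp: young_le_def list_all2_conv_all_nth)
  have less: "i < count_list (take k Q) N" if "i < count_list (take k P) N" for i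
  proof -
    have i: "i < length (step_sequence Q)" "step_sequence P ! i + i < k"
      using that len unfolding less_count_take_iff by simp_all
    with le[OF i(1)] show ?thesis
      unfolding less_count_take_iff by linarith
  qed
  show "count_list (take k P) N \<le> count_list (take k Q) N"
    using less[of "count_list (take k Q) N"] by (cases "count_list (take k Q) N < count_list (take k P) N") simp_all
qed

lemma count_list_replicate_E [simp]: "count_list (replicate m E) N = 0"
  by (induction m) simp_all

text \<open>Up to the end of the exchanged factors the new path has only one north step after \<open>A\<close>, and \<open>Q\<close>
  has one at the same place; beyond them the prefix counts are the old ones.\<close>

lemma prefix_dominated_exchange:
  assumes "prefix_dominated (A @ replicate c E @ N # replicate m E @ W) (A @ N # D)"
  shows "prefix_dominated (A @ N # replicate (m + c) E @ W) (A @ N # D)"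
  unfolding prefix_dominated_def
proof (intro allI)
  fix k
  show "count_list (take k (A @ N # replicate (m + c) E @ W)) N \<le> count_list (take k (A @ N # D)) N"
  proof (cases "k \<le> length A + m + c")
    case True
    then show ?thesis
      by (cases "k - length A") auto
  next
    case False
    then obtain j where "k = length A + c + Suc (m + j)"
      using less_imp_Suc_add[of "length A + m + c" k] by auto
    then show ?thesis
      using assms[unfolded prefix_dominated_def, rule_format, of k] by (simp add: add.commute)
  qed
qed

text \<open>The invariant: \<open>A\<close> is a common prefix of the two paths, and the reworked part \<open>U\<close> contributes
  only letters \<open>E\<close> beyond it. Hence the north step that is moved next lies on the spine.\<close>

lemma rotations_reach:
  assumes "U \<noteq> \<langle>\<rangle>" and "omega1 U = A @ replicate t E" and "Q = A @ D"
    and "prefix_dominated (omega1 U @ spine_word ms) Q"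
    and "length (omega1 U @ spine_word ms) = length Q"
    and "count_list (omega1 U @ spine_word ms) N = count_list Q N"
  shows "\<exists>T. (rotation Q)\<^sup>*\<^sup>* (omega1 U @ spine_word ms, spine U ms) (Q, T) \<and>
    omega1 T = Q \<and> omega2 T = omega2 U @ spine_word ms"
  using assms
proof (induction "length D" arbitrary: U A t D ms rule: less_induct)
  case less
  let ?W = "replicate t E @ spine_word ms"
  show ?case
  proof (cases "?W = D")
    case True
    then show ?thesis
      using less.prems by (intro exI[of _ "spine U ms"]) (simp add: omega1_spine omega2_spine)
  next
    case False
    moreover have "length ?W = length D"
      using less.prems(2,3,5) by simp
    ultimately obtain B s C s' D' where diff: "?W = B @ s # C" "D = B @ s' # D'" "s \<noteq> s'"
      using same_length_different[of ?W D] by auto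
    have R: "omega1 U @ spine_word ms = A @ ?W"
      using less.prems(2) by simp
    have "count_list (take (Suc (length (A @ B))) (A @ B @ s # C)) N \<le>
        count_list (take (Suc (length (A @ B))) (A @ B @ s' # D')) N"
      using less.prems(4) unfolding R less.prems(3) diff prefix_dominated_def by blast
    then have s: "s = E" "s' = N"
      using diff(3) by (cases s; cases s'; simp)+
    have "N \<in> set C"
    proof (rule ccontr)
      assume "N \<notin> set C"
      then show False
        using less.prems(6) unfolding R less.prems(3) diff s by (simp add: count_list_0_iff)
    qed
    then obtain X Y where XY: "C = X @ N # Y" "N \<notin> set X"
      by (meson split_list_first)
    define c where "c = Suc (length X)"
    have "X = replicate (length X) E"
      using XY(2) by (intro replicate_eqI) (simp, metis step.exhaust)
    then have W: "?W = (B @ replicate c E) @ N # Y"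
      by (simp add: diff(1) s XY(1) c_def)
    from W obtain Z where Z: "B @ replicate c E = replicate t E @ Z" "spine_word ms = Z @ N # Y"
      by (rule replicate_E_append_eq_append_N)
    obtain ms1 m ms2 where ms: "ms = ms1 @ m # ms2" "Z = spine_word ms1"
      "Y = replicate m E @ spine_word ms2"
      using spine_word_split[OF Z(2)] by blast
    define U1 where "U1 = spine U ms1"
    have U1: "U1 \<noteq> \<langle>\<rangle>" "omega1 U1 = (A @ B) @ replicate c E" "omega2 U1 = omega2 U @ spine_word ms1"
      using less.prems(1,2) Z(1) by (simp_all add: U1_def omega1_spine omega2_spine ms(2))
    have Q: "Q = (A @ B) @ N # D'"
      using less.prems(3) diff(2) s(2) by simp
    obtain U' where U': "U' \<noteq> \<langle>\<rangle>" "omega1 U' = ((A @ B) @ [N]) @ replicate (m + c) E"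
      "omega2 U' = omega2 U1 @ N # replicate m E"
      and rot: "rotation Q (omega1 U1 @ spine_word (m # ms2), spine U1 (m # ms2))
        (omega1 U' @ spine_word ms2, spine U' ms2)"
      using rotation_step[OF U1(1,2) _ Q, of m ms2] by (auto simp: c_def)
    have R': "omega1 U @ spine_word ms = (A @ B) @ replicate c E @ N # replicate m E @ spine_word ms2"
      using R W ms(3) by simp
    have start: "omega1 U1 @ spine_word (m # ms2) = omega1 U @ spine_word ms"
      "spine U1 (m # ms2) = spine U ms"
      unfolding R' by (simp_all add: U1(2)) (simp add: U1_def ms(1) spine_append)
    have "\<exists>T. (rotation Q)\<^sup>*\<^sup>* (omega1 U' @ spine_word ms2, spine U' ms2) (Q, T) \<and>
        omega1 T = Q \<and> omega2 T = omega2 U' @ spine_word ms2"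
    proof (rule less.hyps[OF _ U'(1,2)])
      show "length D' < length D"
        by (simp add: diff(2))
      show "Q = ((A @ B) @ [N]) @ D'"
        using Q by simp
      show "prefix_dominated (omega1 U' @ spine_word ms2) Q"
        using prefix_dominated_exchange[of "A @ B" c m "spine_word ms2" D'] less.prems(4)
        unfolding R' Q U'(2) by simp
      show "length (omega1 U' @ spine_word ms2) = length Q"
        using less.prems(5) unfolding R' U'(2) by simp
      show "count_list (omega1 U' @ spine_word ms2) N = count_list Q N"
        using less.prems(6) unfolding R' U'(2) by simp
    qed
    moreover have "omega2 U' @ spine_word ms2 = omega2 U @ spine_word ms"
      by (simp add: U'(3) U1(3) ms(1))
    ultimately show ?thesis
      using rot unfolding start by (metis converse_rtranclp_into_rtranclp)
  qed
qed

lemma rotations_to_target_unique: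
  assumes "(rotation Q)\<^sup>*\<^sup>* s (Q, T)" and "(rotation Q)\<^sup>*\<^sup>* s (Q, T')"
  shows "T = T'"
  using assms
proof (induction s rule: converse_rtranclp_induct)
  case base
  then show ?case
    by (auto elim: converse_rtranclpE simp: no_rotation_from_target)
next
  case (step s s')
  from step.prems show ?case
  proof (cases rule: converse_rtranclpE)
    case base
    with step.hyps(1) no_rotation_from_target show ?thesis
      by blast
  next
    case (step s'')
    with step.hyps(1) rotation_right_unique have "s'' = s'"
      by blast
    with step step.IH show ?thesis
      by blast
  qed
qed

lemma B_tree_eqI: "(rotation Q)\<^sup>*\<^sup>* (P, Tr P) (Q, T) \<Longrightarrow> B_tree Q P = T"
  unfolding B_tree_def by (rule the_equality) (auto dest: rotations_to_target_unique)

lemma dyck_path_hd: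
  assumes "a > 0" and "P \<in> dyck_paths a b n"
  shows "P = [] \<or> hd P = N"
proof (cases P)
  case (Cons s P')
  then have "a * count_list [s] E \<le> b * count_list [s] N"
    using assms(2) by (auto simp: dyck_paths_def dest!: spec[of _ 1])
  then show ?thesis
    using Cons assms(1) by (cases s) auto
qed simp

lemma length_path: "length P = count_list P E + count_list P N"
proof (induction P)
  case (Cons s P)
  then show ?case
    by (cases s) simp_all
qed simp

theorem proposition7p2:
  fixes a b n :: nat and P Q :: path
  assumes "a > 0" and "b > 0" and "coprime a b" and "n \<ge> 1"
    and "P \<in> dyck_paths a b n" and "Q \<in> dyck_paths a b n"
    and "P \<le>\<^sub>Y Q"
  shows "omega1 (B_tree Q P) = Q \<and> omega2 (B_tree Q P) = P"
proof -
  obtain ms where ms: "spine_word ms = P" "Tr P = spine single ms"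
    using Tr_blocks_spine[OF dyck_path_hd[OF assms(1,5)]] unfolding Tr_def by blast
  have count: "count_list P N = count_list Q N" "length P = length Q"
    using assms(5,6) by (simp_all add: dyck_paths_def length_path)
  obtain T where "(rotation Q)\<^sup>*\<^sup>* (P, Tr P) (Q, T)" "omega1 T = Q" "omega2 T = P"
    using rotations_reach[of single "[]" 0 Q Q ms] young_le_prefix_dominated[OF assms(7)] count
    by (auto simp: ms)
  then show ?thesis
    by (simp add: B_tree_eqI)
qed

end
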